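(* For all integers $n \ge 2$ and $k \ge 1$, the number $L_3(2n,2k)$ of domino tilings of the right-angle (L-shaped) grid with sizes $3\times 2n\times 2k$ satisfies $$L_3(2n,2k) = A_n A_k + C_{n-1}B_{k-1} + B_{n-2}B_{k-1},$$ where $A_m$, $B_m$, $C_m$ are the numbers of domino tilings of the $3\times 2m$ rectangle, of the $3\times(2m+1)$ rectangle with one corner square removed, and of the $3\times(2m+2)$ rectangle with a corner square and its neighbour along the long side removed, respectively.
   Context: Identify unit squares with points $(i,j)\in\mathbb{Z}^2$. A grid is a finite set of unit squares. A domino is a pair of unit squares sharing an edge, i.e. $\{(i,j),(i+1,j)\}$ or $\{(i,j),(i,j+1)\}$. A domino tiling of a grid is a partition of its set of squares into dominoes; tilings are counted as distinct partitions (no identification under symmetry). Grids: - $A_m$ ($m\ge 1$) is the number of domino tilings of $\{1,\dots,2m\}\times\{1,2,3\}$. - $B_m$ ($m\ge 0$) is the number of domino tilings of $\bigl(\{1,\dots,2m+1\}\times\{1,2,3\}\bigr)\setminus\{(1,3)\}$. - $C_m$ ($m\ge 0$) is the number of domino tilings of $\bigl(\{1,\dots,2m+2\}\times\{1,2,3\}\bigr)\setminus\{(1,3),(2,3)\}$. - $L_3(2n,2k)$ ($n\ge 2$, $k\ge 1$) is the number of domino tilings of the right-angle grid $$\bigl(\{1,2,3\}\times\{1,\dots,2n\}\bigr)\ \cup\ \bigl(\{4,\dots,2k+3\}\times\{1,2,3\}\bigr),$$ composed of a vertical $3\times 2n$ rectangle and a horizontal $3\times 2k$ rectangle attached to the lowest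 three rows of its right side. *)

theory Defs
  imports Main "HOL-Library.Disjoint_Sets"
begin

type_synonym square = "int \<times> int"

definition is_domino :: "square set \<Rightarrow> bool" where
  "is_domino d \<longleftrightarrow> (\<exists>i j. d = {(i, j), (i + 1, j)} \<or> d = {(i, j), (i, j + 1)})"

definition domino_tilings :: "square set \<Rightarrow> square set set set" where
  "domino_tilings G = {T. partition_on G T \<and> (\<forall>d\<in>T. is_domino d)}"

(* For a finite grid G there are only finitely many tilings, so card is the true count here. *)
definition num_tilings :: "square set \<Rightarrow> nat" where
  "num_tilings G = card (domino_tilings G)"

definition A_grid :: "nat \<Rightarrow> square set" where
  "A_grid m = {1..2 * int m} \<times> {1..3}"

definition B_grid :: "nat \<Rightarrow> square set" where
  "B_grid m = ({1..2 * int m + 1} \<times> {1..3}) - {(1, 3)}"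

definition C_grid :: "nat \<Rightarrow> square set" where
  "C_grid m = ({1..2 * int m + 2} \<times> {1..3}) - {(1, 3), (2, 3)}"

(* The two arguments are the actual side lengths: the grid of L_3(2n,2k) is L3_grid (2*n) (2*k). *)
definition L3_grid :: "nat \<Rightarrow> nat \<Rightarrow> square set" where
  "L3_grid h w = ({1..3} \<times> {1..int h}) \<union> ({4..int w + 3} \<times> {1..3})"

definition A :: "nat \<Rightarrow> nat" where "A m = num_tilings (A_grid m)"
definition B :: "nat \<Rightarrow> nat" where "B m = num_tilings (B_grid m)"
definition C :: "nat \<Rightarrow> nat" where "C m = num_tilings (C_grid m)"
definition L3 :: "nat \<Rightarrow> nat \<Rightarrow> nat" where "L3 h w = num_tilings (L3_grid h w)"

end

theory Submission
  imports Defs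
begin

text \<open>
  Write the L-shaped grid as the disjoint union of the vertical leg
  \<open>{1..3} \<times> {1..2n}\<close> and the horizontal arm \<open>{4..2k + 3} \<times> {1..3}\<close>. They touch along
  three edges only, so a tiling is determined by the set \<open>S \<subseteq> {1, 2, 3}\<close> of rows in which
  a domino bridges the gap between columns 3 and 4, together with independent tilings of what
  is left of the leg and of the arm (\<open>num_tilings_Un\<close>, \<open>L3_eq_sum_bridges\<close>).

  In the chequerboard colouring the leg is balanced, hence it can be completed only if the
  squares that the bridges take from it are balanced too
  (\<open>num_tilings_eq_0_if_unbalanced\<close>). The squares in rows 1, 2, 3 of
  column 3 alternate in colour, which leaves \<open>S = {}\<close>, \<open>{1, 2}\<close> and \<open>{2, 3}\<close>. These give
  the three summands:

  \<^item> For \<open>S = {}\<close> both rectangles are intact: \<open>A n * A k\<close>.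

  \<^item> For \<open>S = {1, 2}\<close> the leg loses a corner and its neighbour along the long side, which is
    the shape counted by \<open>C (n - 1)\<close>. In the arm the square \<open>(4, 3)\<close> can only be paired with
    \<open>(5, 3)\<close>, and the shape counted by \<open>B (k - 1)\<close> remains.

  \<^item> For \<open>S = {2, 3}\<close> the arm is the mirror image of the previous one. In the leg a chain of
    four forced dominoes uses up what is left of the three lowest rows and the square
    \<open>(1, 4)\<close>, and the shape counted by \<open>B (n - 2)\<close> remains.

  The remaining shapes agree with the reference shapes up to a symmetry of the square lattice, under
  which the number of tilings is invariant (\<open>num_tilings_isometry\<close>).
\<close>

section \<open>Tilings and isometries of the grid\<close>

lemma domino_tilings_iff:
  "T \<in> domino_tilings G \<longleftrightarrow> \<Union>T = G \<and> disjoint T \<and> (\<forall>d\<in>T. is_domino d)"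
  by (auto simp: domino_tilings_def partition_on_def is_domino_def)

lemma finite_domino_tilings: "finite G \<Longrightarrow> finite (domino_tilings G)"
  by (rule finite_subset[of _ "Pow (Pow G)"]) (auto simp: domino_tilings_iff)

text \<open>
  The taxicab metric. A domino is a pair of squares at distance 1, so any map that preserves
  this metric maps dominoes to dominoes; this covers swaps, translations and reflections at once.
\<close>

definition sq_dist :: "square \<Rightarrow> square \<Rightarrow> int" where
  "sq_dist p q = \<bar>fst p - fst q\<bar> + \<bar>snd p - snd q\<bar>"

lemma is_domino_iff: "is_domino d \<longleftrightarrow> (\<exists>p q. d = {p, q} \<and> sq_dist p q = 1)"
proof
  assume "is_domino d"
  then obtain i j where "d = {(i, j), (i + 1, j)} \<or> d = {(i, j), (i, j + 1)}"
    by (auto simp: is_domino_def)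
  then show "\<exists>p q. d = {p, q} \<and> sq_dist p q = 1"
  proof
    assume "d = {(i, j), (i + 1, j)}"
    then show ?thesis by (intro exI[of _ "(i, j)"] exI[of _ "(i + 1, j)"]) (simp add: sq_dist_def)
  next
    assume "d = {(i, j), (i, j + 1)}"
    then show ?thesis by (intro exI[of _ "(i, j)"] exI[of _ "(i, j + 1)"]) (simp add: sq_dist_def)
  qed
next
  assume "\<exists>p q. d = {p, q} \<and> sq_dist p q = 1"
  then obtain a b x y where d: "d = {(a, b), (x, y)}" and dist: "\<bar>a - x\<bar> + \<bar>b - y\<bar> = 1"
    by (auto simp: sq_dist_def)
  from dist consider "x = a + 1" "y = b" | "a = x + 1" "y = b" | "x = a" "y = b + 1" | "x = a" "b = y + 1"
    by linarith
  then show "is_domino d"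
    unfolding is_domino_def d by cases (auto simp: insert_commute)
qed

text \<open>
  An isometry is injective and both preserves and reflects dominoes, so taking images of blocks
  is a bijection between the tilings of \<open>G\<close> and those of its image.
\<close>

lemma num_tilings_isometry:
  assumes isom: "\<And>p q. sq_dist (f p) (f q) = sq_dist p q"
  shows "num_tilings (f ` G) = num_tilings G"
proof -
  have inj: "inj f"
  proof (rule injI)
    fix p q assume "f p = f q"
    then have "sq_dist p q = 0" using isom[of p q] by (simp add: sq_dist_def)
    then show "p = q" unfolding sq_dist_def prod_eq_iff by linarith
  qed
  have dom: "is_domino (f ` d) \<longleftrightarrow> is_domino d" for d
  proof
    assume "is_domino d"
    then show "is_domino (f ` d)" unfolding is_domino_iff using isom by (metis image_empty image_insert)
  next
    assume "is_domino (f ` d)"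
    then obtain p q where pq: "f ` d = {p, q}" "sq_dist p q = 1" by (auto simp: is_domino_iff)
    then obtain p' q' where "p' \<in> d" "q' \<in> d" "p = f p'" "q = f q'" by blast
    with pq have "f ` d = f ` {p', q'}" "sq_dist p' q' = 1" by (auto simp: isom)
    then show "is_domino d" unfolding is_domino_iff inj_image_eq_iff[OF inj] by blast
  qed
  have disj: "disjoint ((`) f ` T) \<longleftrightarrow> disjoint T" for T
    by (auto simp: disjoint_def inj_image_eq_iff[OF inj] simp flip: image_Int[OF inj])
  have tilings: "(`) f ` T \<in> domino_tilings (f ` G) \<longleftrightarrow> T \<in> domino_tilings G" for T
    by (simp add: domino_tilings_iff disj dom inj_image_eq_iff[OF inj] flip: image_Union)
  have "domino_tilings (f ` G) = (\<lambda>T. (`) f ` T) ` domino_tilings G"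
  proof (intro equalityI subsetI)
    fix T' assume T': "T' \<in> domino_tilings (f ` G)"
    have "d \<in> range ((`) f)" if "d \<in> T'" for d
    proof -
      have "d \<subseteq> f ` G" using T' that by (auto simp: domino_tilings_iff)
      then show ?thesis by (auto simp: subset_image_iff)
    qed
    then have "T' \<subseteq> range ((`) f)" by blast
    then obtain T where "T' = (`) f ` T" by (auto simp: subset_image_iff)
    with T' show "T' \<in> (\<lambda>T. (`) f ` T) ` domino_tilings G" by (auto simp: tilings)
  qed (auto simp: tilings)
  moreover have "inj ((`) f)" by (rule injI) (simp add: inj_image_eq_iff[OF inj])
  then have "inj (\<lambda>T. (`) f ` T)" by (intro injI) (simp add: inj_image_eq_iff)
  then have "inj_on (\<lambda>T. (`) f ` T) (domino_tilings G)" by (rule inj_on_subset) simp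
  ultimately show ?thesis
    unfolding num_tilings_def by (simp add: card_image)
qed

lemma bij_image_eq_Collect:
  assumes "\<And>p. f (g p) = p" "\<And>p. g (f p) = p"
  shows "f ` G = {p. g p \<in> G}"
proof (intro equalityI subsetI)
  fix p assume "p \<in> {p. g p \<in> G}"
  then show "p \<in> f ` G" using assms(1)[of p, symmetric] by blast
qed (auto simp: assms(2))

lemma sq_dist_grid_maps:
  "sq_dist (prod.swap p) (prod.swap q) = sq_dist p q"
  "sq_dist ((\<lambda>(x, y). (x + a, y + b)) p) ((\<lambda>(x, y). (x + a, y + b)) q) = sq_dist p q"
  "sq_dist ((\<lambda>(x, y). (x, a - y)) p) ((\<lambda>(x, y). (x, a - y)) q) = sq_dist p q"
  by (cases p; cases q; simp add: sq_dist_def)+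

lemma num_tilings_swap: "num_tilings {(x, y). (y, x) \<in> G} = num_tilings G"
proof -
  have "{(x, y). (y, x) \<in> G} = prod.swap ` G"
    by (subst bij_image_eq_Collect[where g = prod.swap]) auto
  then show ?thesis by (simp add: num_tilings_isometry sq_dist_grid_maps)
qed

lemma num_tilings_translate: "num_tilings {(x, y). (x - a, y - b) \<in> G} = num_tilings G"
proof -
  have "{(x, y). (x - a, y - b) \<in> G} = (\<lambda>(x, y). (x + a, y + b)) ` G"
    by (subst bij_image_eq_Collect[where g = "\<lambda>(x, y). (x - a, y - b)"]) auto
  then show ?thesis by (simp only: num_tilings_isometry sq_dist_grid_maps)
qed

lemma num_tilings_reflect: "num_tilings {(x, y). (x, a - y) \<in> G} = num_tilings G"
proof -
  have "{(x, y). (x, a - y) \<in> G} = (\<lambda>(x, y). (x, a - y)) ` G"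
    by (subst bij_image_eq_Collect[where g = "\<lambda>(x, y). (x, a - y)"]) auto
  then show ?thesis by (simp only: num_tilings_isometry sq_dist_grid_maps)
qed

section \<open>Cutting a grid in two\<close>

text \<open>
  Sort the tilings by the set \<open>D\<close> of dominoes that meet both parts. Once \<open>D\<close> is fixed, every
  other domino lies inside one part and avoids the squares of \<open>D\<close>, so it remains to tile
  \<open>V - \<Union>D\<close> and \<open>H - \<Union>D\<close> independently of each other.
\<close>

lemma num_tilings_Un:
  assumes "finite V" "finite H" "V \<inter> H = {}"
  defines "X \<equiv> {d. is_domino d \<and> d \<subseteq> V \<union> H \<and> d \<inter> V \<noteq> {} \<and> d \<inter> H \<noteq> {}}"
  shows "num_tilings (V \<union> H) =
    (\<Sum>D | D \<subseteq> X \<and> disjoint D. num_tilings (V - \<Union>D) * num_tilings (H - \<Union>D))"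
proof -
  let ?\<D> = "{D. D \<subseteq> X \<and> disjoint D}"
  have "finite X"
    by (rule finite_subset[of _ "Pow (V \<union> H)"]) (use assms in auto)
  then have fin: "finite ?\<D>" by simp
  have fibre: "card {T \<in> domino_tilings (V \<union> H). T \<inter> X = D} =
      num_tilings (V - \<Union>D) * num_tilings (H - \<Union>D)" if D: "D \<in> ?\<D>" for D
  proof -
    have DX: "D \<subseteq> X" and disjD: "disjoint D" using D by auto
    let ?join = "\<lambda>(P, Q). P \<union> Q \<union> D"
    let ?cut = "\<lambda>T. ({d \<in> T. d \<subseteq> V}, {d \<in> T. d \<subseteq> H})"
    have "bij_betw ?join (domino_tilings (V - \<Union>D) \<times> domino_tilings (H - \<Union>D))
        {T \<in> domino_tilings (V \<union> H). T \<inter> X = D}"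
    proof (rule bij_betw_byWitness[where f' = ?cut])
      have ne: "d \<noteq> {}" if "is_domino d" for d using that by (auto simp: is_domino_def)
      have sides: "d \<subseteq> V \<and> \<not> d \<subseteq> H \<and> d \<notin> X \<and> d \<inter> \<Union>D = {}"
        if "d \<in> P" "P \<in> domino_tilings (V - \<Union>D)" for d P
        using that ne[of d] \<open>V \<inter> H = {}\<close> unfolding X_def domino_tilings_iff by blast
      have sides': "d \<subseteq> H \<and> \<not> d \<subseteq> V \<and> d \<notin> X \<and> d \<inter> \<Union>D = {}"
        if "d \<in> Q" "Q \<in> domino_tilings (H - \<Union>D)" for d Q
        using that ne[of d] \<open>V \<inter> H = {}\<close> unfolding X_def domino_tilings_iff by blast
      have crossing: "\<not> d \<subseteq> V \<and> \<not> d \<subseteq> H \<and> is_domino d \<and> d \<subseteq> V \<union> H" if "d \<in> X" for d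
        using that \<open>V \<inter> H = {}\<close> unfolding X_def by blast
      show "\<forall>PQ\<in>domino_tilings (V - \<Union>D) \<times> domino_tilings (H - \<Union>D). ?cut (?join PQ) = PQ"
      proof
        fix PQ assume "PQ \<in> domino_tilings (V - \<Union>D) \<times> domino_tilings (H - \<Union>D)"
        then obtain P Q where PQ: "PQ = (P, Q)" "P \<in> domino_tilings (V - \<Union>D)"
          "Q \<in> domino_tilings (H - \<Union>D)" by auto
        have "{d \<in> P \<union> Q \<union> D. d \<subseteq> V} = P" "{d \<in> P \<union> Q \<union> D. d \<subseteq> H} = Q"
          using sides[OF _ PQ(2)] sides'[OF _ PQ(3)] crossing DX by blast+
        then show "?cut (?join PQ) = PQ" by (simp add: PQ)
      qed
      show "\<forall>T\<in>{T \<in> domino_tilings (V \<union> H). T \<inter> X = D}. ?join (?cut T) = T"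
      proof
        fix T assume T: "T \<in> {T \<in> domino_tilings (V \<union> H). T \<inter> X = D}"
        then have "d \<subseteq> V \<or> d \<subseteq> H \<or> d \<in> D" if "d \<in> T" for d
          using that unfolding X_def domino_tilings_iff by blast
        with T show "?join (?cut T) = T" by auto
      qed
      show "?join ` (domino_tilings (V - \<Union>D) \<times> domino_tilings (H - \<Union>D))
          \<subseteq> {T \<in> domino_tilings (V \<union> H). T \<inter> X = D}"
      proof
        fix T assume "T \<in> ?join ` (domino_tilings (V - \<Union>D) \<times> domino_tilings (H - \<Union>D))"
        then obtain P Q where T: "T = P \<union> Q \<union> D" and P: "P \<in> domino_tilings (V - \<Union>D)"
          and Q: "Q \<in> domino_tilings (H - \<Union>D)" by auto
        have "\<Union>D \<subseteq> V \<union> H" using DX crossing by blast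
        then have "\<Union>T = V \<union> H" using P Q by (auto simp: T domino_tilings_iff)
        moreover have "disjoint T"
          unfolding T
        proof (intro disjoint_union disjD)
          show "disjoint P" "disjoint Q" using P Q by (auto simp: domino_tilings_iff)
          show "\<Union>P \<inter> \<Union>Q = {}" "\<Union>(P \<union> Q) \<inter> \<Union>D = {}"
            using P Q \<open>V \<inter> H = {}\<close> by (auto simp: domino_tilings_iff)
        qed
        moreover have "\<forall>d\<in>T. is_domino d"
          using P Q DX crossing by (auto simp: T domino_tilings_iff)
        moreover have "T \<inter> X = D" using sides[OF _ P] sides'[OF _ Q] DX T by blast
        ultimately show "T \<in> {T \<in> domino_tilings (V \<union> H). T \<inter> X = D}"
          by (simp add: domino_tilings_iff)
      qed
      show "?cut ` {T \<in> domino_tilings (V \<union> H). T \<inter> X = D}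
          \<subseteq> domino_tilings (V - \<Union>D) \<times> domino_tilings (H - \<Union>D)"
      proof (rule image_subsetI)
        fix T assume "T \<in> {T \<in> domino_tilings (V \<union> H). T \<inter> X = D}"
        then have T: "\<Union>T = V \<union> H" "disjoint T" "\<forall>d\<in>T. is_domino d" "T \<inter> X = D"
          by (auto simp: domino_tilings_iff)
        have part: "{d \<in> T. d \<subseteq> W} \<in> domino_tilings (W - \<Union>D)" if "W = V \<or> W = H" for W
        proof -
          have apart: "d \<inter> e = {}" if "d \<in> T" "d \<subseteq> W" "e \<in> D" for d e
          proof -
            have "d \<noteq> e" using that crossing DX \<open>W = V \<or> W = H\<close> by blast
            then show ?thesis using that T(2,4) by (auto dest: disjointD)
          qed
          have cover: "\<exists>d\<in>T. d \<subseteq> W \<and> p \<in> d" if "p \<in> W" "p \<notin> \<Union>D" for p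
          proof -
            from that T(1) \<open>W = V \<or> W = H\<close> obtain d where d: "d \<in> T" "p \<in> d" by blast
            with that T(4) have "d \<notin> X" by blast
            with d T(1,3) \<open>p \<in> W\<close> \<open>W = V \<or> W = H\<close> \<open>V \<inter> H = {}\<close> have "d \<subseteq> W"
              unfolding X_def by blast
            with d show ?thesis by blast
          qed
          have "\<Union>{d \<in> T. d \<subseteq> W} = W - \<Union>D"
          proof (intro equalityI subsetI)
            fix p assume "p \<in> \<Union>{d \<in> T. d \<subseteq> W}"
            then obtain d where "d \<in> T" "d \<subseteq> W" "p \<in> d" by blast
            then show "p \<in> W - \<Union>D" using apart[of d] by blast
          next
            fix p assume "p \<in> W - \<Union>D"
            then show "p \<in> \<Union>{d \<in> T. d \<subseteq> W}" using cover[of p] by blast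
          qed
          moreover have "disjoint {d \<in> T. d \<subseteq> W}"
            using T(2) by (rule pairwise_subset) auto
          ultimately show ?thesis using T(3) by (simp add: domino_tilings_iff)
        qed
        then show "?cut T \<in> domino_tilings (V - \<Union>D) \<times> domino_tilings (H - \<Union>D)" by simp
      qed
    qed
    then show ?thesis
      using bij_betw_same_card by (fastforce simp: num_tilings_def card_cartesian_product)
  qed
  have "domino_tilings (V \<union> H) = (\<Union>D\<in>?\<D>. {T \<in> domino_tilings (V \<union> H). T \<inter> X = D})"
    by (auto simp: domino_tilings_iff intro: pairwise_subset)
  then have "num_tilings (V \<union> H) =
      card (\<Union>D\<in>?\<D>. {T \<in> domino_tilings (V \<union> H). T \<inter> X = D})"
    unfolding num_tilings_def by (rule arg_cong)
  also have "\<dots> = (\<Sum>D\<in>?\<D>. card {T \<in> domino_tilings (V \<union> H). T \<inter> X = D})"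
    using fin assms(1,2) by (intro card_UN_disjoint) (auto simp: finite_domino_tilings)
  finally show ?thesis using fibre by simp
qed

section \<open>The chequerboard colouring\<close>

definition imbalance :: "square set \<Rightarrow> int" where
  "imbalance G = (\<Sum>(i, j)\<in>G. if even (i + j) then 1 else - 1)"

text \<open>Every domino covers one square of each colour.\<close>

lemma num_tilings_eq_0_if_unbalanced:
  assumes "finite G" "imbalance G \<noteq> 0"
  shows "num_tilings G = 0"
proof -
  have "domino_tilings G = {}"
  proof (rule ccontr)
    assume "domino_tilings G \<noteq> {}"
    then obtain T where T: "\<Union>T = G" "disjoint T" "\<forall>d\<in>T. is_domino d"
      by (metis all_not_in_conv domino_tilings_iff)
    have "imbalance G = (\<Sum>d\<in>T. imbalance d)"
      unfolding imbalance_def T(1)[symmetric]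
      by (rule sum.Union_disjoint[unfolded comp_def])
        (use T assms(1) in \<open>auto simp: disjoint_def intro: finite_subset\<close>)
    also have "\<dots> = 0"
      by (rule sum.neutral) (use T in \<open>auto simp: imbalance_def is_domino_def\<close>)
    finally show False using assms by simp
  qed
  then show ?thesis by (simp add: num_tilings_def)
qed

text \<open>The squares of each column alternate in colour, and each column has even length.\<close>

lemma imbalance_rectangle: "imbalance (I \<times> {1..2 * int n}) = 0"
proof -
  have "(\<Sum>j\<in>{1..2 * int n}. if even (i + j) then 1 else - 1 :: int) = 0" for i
  proof (induction n)
    case (Suc n)
    have "{1..2 * int (Suc n)} = {1..2 * int n} \<union> {2 * int n + 1, 2 * int n + 2}" by auto
    then show ?case using Suc by (auto simp: sum.union_disjoint)
  qed simp
  then show ?thesis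
    unfolding imbalance_def by (simp flip: sum.cartesian_product)
qed

section \<open>Forced dominoes\<close>

lemma num_tilings_empty: "num_tilings {} = 1"
proof -
  have "domino_tilings {} = {{}}"
    by (fastforce simp: domino_tilings_def partition_on_empty)
  then show ?thesis by (simp add: num_tilings_def)
qed

text \<open>
  A square with a single neighbour \<open>c'\<close> in the grid must be paired with it. This is the cutting
  lemma for \<open>{(i, j)}\<close> and the rest of the grid: the only domino across the cut is
  \<open>{(i, j), c'}\<close>, and a tiling without it would have to tile a single square.
\<close>

lemma num_tilings_forced:
  assumes "finite G" "(i, j) \<in> G"
    and nbr: "{(i + 1, j), (i - 1, j), (i, j + 1), (i, j - 1)} \<inter> G = {c'}"
  shows "num_tilings G = num_tilings (G - {(i, j), c'})"
proof -
  define c where "c = (i, j)"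
  have nbr_iff: "sq_dist c e = 1 \<longleftrightarrow> e \<in> {(i + 1, j), (i - 1, j), (i, j + 1), (i, j - 1)}" for e
    unfolding sq_dist_def c_def by (cases e; simp) arith
  have c: "c \<in> G" "c' \<in> G" "sq_dist c c' = 1"
    and only: "\<And>e. e \<in> G \<Longrightarrow> sq_dist c e = 1 \<Longrightarrow> e = c'"
    using assms(2) nbr unfolding nbr_iff c_def[symmetric] by blast+
  have sym: "sq_dist p q = sq_dist q p" for p q by (simp add: sq_dist_def abs_minus_commute)
  have "c \<noteq> c'" using c(3) by (auto simp: sq_dist_def)
  have X: "{d. is_domino d \<and> d \<subseteq> {c} \<union> (G - {c}) \<and> d \<inter> {c} \<noteq> {} \<and> d \<inter> (G - {c}) \<noteq> {}}
      = {{c, c'}}"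
    (is "?X = _")
  proof (intro equalityI subsetI)
    fix d assume d: "d \<in> ?X"
    then obtain p q where pq: "d = {p, q}" "sq_dist p q = 1" by (auto simp: is_domino_iff)
    with d consider "p = c" "q \<in> G" | "q = c" "p \<in> G" by blast
    then have "d = {c, c'}"
    proof cases
      case 1
      with pq only[of q] show ?thesis by simp
    next
      case 2
      with pq only[of p] sym[of p q] show ?thesis by (simp add: insert_commute)
    qed
    then show "d \<in> {{c, c'}}" by simp
  next
    fix d assume "d \<in> {{c, c'}}"
    moreover have "is_domino {c, c'}" using c(3) by (auto simp only: is_domino_iff)
    ultimately show "d \<in> ?X" using c(1,2) \<open>c \<noteq> c'\<close> by simp
  qed
  have D: "{D. D \<subseteq> {{c, c'}} \<and> disjoint D} = {{}, {{c, c'}}}"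
    by (auto simp: subset_singleton_iff)
  have G: "G = {c} \<union> (G - {c})" using c(1) by auto
  have "num_tilings {c} = 0" by (rule num_tilings_eq_0_if_unbalanced) (auto simp: imbalance_def c_def)
  moreover have "G - {c} - {c, c'} = G - {c, c'}" by auto
  ultimately show ?thesis
    using num_tilings_Un[of "{c}" "G - {c}", unfolded X D, folded G] assms(1)
    by (simp add: num_tilings_empty flip: c_def)
qed

section \<open>The L-shaped grid\<close>

definition leg :: "nat \<Rightarrow> square set" where
  "leg n = {1..3} \<times> {1..2 * int n}"

definition arm :: "nat \<Rightarrow> square set" where
  "arm k = {4..2 * int k + 3} \<times> {1..3}"

lemma mem_leg: "(x, y) \<in> leg n \<longleftrightarrow> 1 \<le> x \<and> x \<le> 3 \<and> 1 \<le> y \<and> y \<le> 2 * int n"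
  by (auto simp: leg_def)

lemma finite_leg: "finite (leg n)" and finite_arm: "finite (arm k)"
  by (simp_all add: leg_def arm_def)

text \<open>
  The three dominoes that bridge columns 3 and 4 are pairwise disjoint, so every set of them can
  occur, and such a set is encoded by its rows.
\<close>

lemma L3_eq_sum_bridges:
  assumes "n \<ge> 2" "k \<ge> 1"
  shows "L3 (2 * n) (2 * k) =
    (\<Sum>S\<in>Pow {1, 2, 3}. num_tilings (leg n - {3} \<times> S) * num_tilings (arm k - {4} \<times> S))"
proof -
  define bridge :: "int \<Rightarrow> square set" where "bridge y = {(3, y), (4, y)}" for y
  let ?X = "{d. is_domino d \<and> d \<subseteq> leg n \<union> arm k \<and> d \<inter> leg n \<noteq> {} \<and> d \<inter> arm k \<noteq> {}}"
  have X: "?X = bridge ` {1, 2, 3}"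
  proof (intro equalityI subsetI)
    fix d assume d: "d \<in> ?X"
    then consider (hor) i j where "d = {(i, j), (i + 1, j)}" | (ver) i j where "d = {(i, j), (i, j + 1)}"
      unfolding is_domino_def by blast
    then show "d \<in> bridge ` {1, 2, 3}"
    proof cases
      case hor
      with d have "i = 3" "1 \<le> j" "j \<le> 3" by (auto simp: leg_def arm_def)
      then have "d = bridge j" "j \<in> {1, 2, 3}" using hor by (auto simp: bridge_def)
      then show ?thesis by blast
    next
      case ver
      with d have False by (auto simp: leg_def arm_def)
      then show ?thesis ..
    qed
  next
    fix d assume "d \<in> bridge ` {1, 2, 3}"
    then obtain y where y: "d = bridge y" "1 \<le> y" "y \<le> 3" by auto
    then have "d = {(3, y), (3 + 1, y)}" by (simp add: bridge_def)
    then have "is_domino d" unfolding is_domino_def by blast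
    then show "d \<in> ?X" using y assms by (auto simp: leg_def arm_def bridge_def)
  qed
  have inj: "inj bridge" by (auto simp: inj_def bridge_def doubleton_eq_iff)
  have disj: "disjoint (bridge ` S)" for S by (auto simp: disjoint_def bridge_def)
  have Ds: "{D. D \<subseteq> bridge ` {1, 2, 3} \<and> disjoint D} = (`) bridge ` Pow {1, 2, 3}"
    unfolding image_Pow_surj[OF refl] using disj by (auto simp only: subset_image_iff Pow_iff)
  have cut: "leg n - \<Union>(bridge ` S) = leg n - {3} \<times> S" "arm k - \<Union>(bridge ` S) = arm k - {4} \<times> S"
    for S by (auto simp: leg_def arm_def bridge_def)
  have "L3_grid (2 * n) (2 * k) = leg n \<union> arm k" by (simp add: L3_grid_def leg_def arm_def)
  moreover have "leg n \<inter> arm k = {}" by (auto simp: leg_def arm_def)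
  ultimately have "L3 (2 * n) (2 * k) =
      (\<Sum>D\<in>(`) bridge ` Pow {1, 2, 3}. num_tilings (leg n - \<Union>D) * num_tilings (arm k - \<Union>D))"
    using num_tilings_Un[OF finite_leg finite_arm, of n k] unfolding L3_def X Ds by simp
  also have "\<dots> = (\<Sum>S\<in>Pow {1, 2, 3}. num_tilings (leg n - {3} \<times> S) * num_tilings (arm k - {4} \<times> S))"
    by (subst sum.reindex) (use inj in \<open>auto simp: cut inj_on_def inj_image_eq_iff\<close>)
  finally show ?thesis .
qed

section \<open>The remaining shapes of leg and arm\<close>

lemma num_tilings_leg: "num_tilings (leg n) = A n"
proof -
  have "leg n = {(x, y). (y, x) \<in> A_grid n}" by (auto simp: leg_def A_grid_def)
  then show ?thesis by (simp add: num_tilings_swap A_def)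
qed

lemma num_tilings_arm: "num_tilings (arm k) = A k"
proof -
  have "arm k = {(x, y). (x - 3, y - 0) \<in> A_grid k}" by (auto simp: arm_def A_grid_def)
  then show ?thesis by (simp only: num_tilings_translate A_def)
qed

lemma num_tilings_leg_low:
  assumes "n \<ge> 1"
  shows "num_tilings (leg n - {3} \<times> {1, 2}) = C (n - 1)"
proof -
  have "leg n - {3} \<times> {1, 2} = {(x, y). (y, x) \<in> C_grid (n - 1)}"
    using assms by (auto simp: leg_def C_grid_def)
  then show ?thesis by (simp add: num_tilings_swap C_def)
qed

text \<open>The square \<open>(4, 3)\<close> left over in the first column of the arm forces \<open>{(4, 3), (5, 3)}\<close>.\<close>

lemma num_tilings_arm_low:
  assumes "k \<ge> 1"
  shows "num_tilings (arm k - {4} \<times> {1, 2}) = B (k - 1)"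
proof -
  have "num_tilings (arm k - {4} \<times> {1, 2}) = num_tilings (arm k - {4} \<times> {1, 2} - {(4, 3), (5, 3)})"
    by (rule num_tilings_forced) (use assms in \<open>auto simp: finite_arm arm_def Int_insert_left\<close>)
  also have "arm k - {4} \<times> {1, 2} - {(4, 3), (5, 3)} = {(x, y). (x - 4, y - 0) \<in> B_grid (k - 1)}"
    using assms by (auto simp: arm_def B_grid_def)
  finally show ?thesis by (simp only: num_tilings_translate B_def)
qed

lemma num_tilings_arm_high:
  assumes "k \<ge> 1"
  shows "num_tilings (arm k - {4} \<times> {2, 3}) = B (k - 1)"
proof -
  have "arm k - {4} \<times> {2, 3} = {(x, y). (x, 4 - y) \<in> arm k - {4} \<times> {1, 2}}"
    by (auto simp: arm_def)
  then show ?thesis by (simp only: num_tilings_reflect num_tilings_arm_low[OF assms])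
qed

text \<open>
  Without \<open>(3, 2)\<close> and \<open>(3, 3)\<close>, the corner \<open>(3, 1)\<close> must be paired with \<open>(2, 1)\<close>, which in
  turn leaves a single partner for \<open>(1, 1)\<close>, then for \<open>(2, 2)\<close>, and then for \<open>(1, 3)\<close>. The
  last of these dominoes reaches into row 4, so the rest is a rectangle with \<open>2 * n - 3\<close> rows
  and a missing corner.
\<close>

lemma num_tilings_leg_high:
  assumes "n \<ge> 2"
  shows "num_tilings (leg n - {3} \<times> {2, 3}) = B (n - 2)"
proof -
  let ?G1 = "leg n - {3} \<times> {2, 3}"
  let ?G2 = "?G1 - {(3, 1), (2, 1)}"
  let ?G3 = "?G2 - {(1, 1), (1, 2)}"
  let ?G4 = "?G3 - {(2, 2), (2, 3)}"
  let ?G5 = "?G4 - {(1, 3), (1, 4)}"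
  have "num_tilings ?G1 = num_tilings ?G2"
    by (rule num_tilings_forced; use assms in \<open>simp add: finite_leg mem_leg Int_insert_left\<close>)
  also have "\<dots> = num_tilings ?G3"
    by (rule num_tilings_forced; use assms in \<open>simp add: finite_leg mem_leg Int_insert_left\<close>)
  also have "\<dots> = num_tilings ?G4"
    by (rule num_tilings_forced; use assms in \<open>simp add: finite_leg mem_leg Int_insert_left\<close>)
  also have "\<dots> = num_tilings ?G5"
    by (rule num_tilings_forced; use assms in \<open>simp add: finite_leg mem_leg Int_insert_left\<close>)
  also have "?G5 = leg n - ({1, 2, 3} \<times> {1, 2, 3} \<union> {(1, 4)})"
    by auto
  also have "{1, 2, 3} = {1..3 :: int}"
    by auto
  \<comment> \<open>Reflecting, shifting and swapping the axes carries the missing corner \<open>(1, 3)\<close> of the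
    reference shape to \<open>(1, 1)\<close>, \<open>(4, 1)\<close> and finally \<open>(1, 4)\<close>.\<close>
  also have "leg n - ({1..3} \<times> {1..3} \<union> {(1, 4)}) =
      {(x, y). (y, x) \<in> {(x, y). (x - 3, y - 0) \<in> {(x, y). (x, 4 - y) \<in> B_grid (n - 2)}}}"
  proof (rule set_eqI)
    fix p :: square
    obtain x y where p: "p = (x, y)" by (cases p)
    have "2 * int (n - 2) + 1 = 2 * int n - 3" using assms by simp
    then show "p \<in> leg n - ({1..3} \<times> {1..3} \<union> {(1, 4)}) \<longleftrightarrow>
        p \<in> {(x, y). (y, x) \<in> {(x, y). (x - 3, y - 0) \<in> {(x, y). (x, 4 - y) \<in> B_grid (n - 2)}}}"
      unfolding p B_grid_def
      by (simp only: mem_leg Diff_iff Un_iff mem_Sigma_iff mem_Collect_eq case_prod_conv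
          singleton_iff prod.inject atLeastAtMost_iff) presburger
  qed
  also have "num_tilings \<dots> = B (n - 2)"
    by (simp only: num_tilings_swap num_tilings_translate num_tilings_reflect B_def)
  finally show ?thesis .
qed

theorem theorem2p1:
  fixes n k :: nat
  assumes "n \<ge> 2" and "k \<ge> 1"
  shows "L3 (2 * n) (2 * k) = A n * A k + C (n - 1) * B (k - 1) + B (n - 2) * B (k - 1)"
proof -
  let ?term = "\<lambda>S. num_tilings (leg n - {3} \<times> S) * num_tilings (arm k - {4} \<times> S)"
  \<comment> \<open>Rows 1, 2, 3 of column 3 have colours \<open>+\<close>, \<open>-\<close>, \<open>+\<close>, and only the three exceptional sets cancel.\<close>
  have unbalanced: "?term S = 0" if "S \<in> Pow {1, 2, 3} - {{}, {1, 2}, {2, 3}}" for S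
  proof -
    have "{3} \<times> {1, 2, 3} \<subseteq> leg n" using assms(1) by (simp add: insert_Times_insert mem_leg)
    with that have "{3} \<times> S \<subseteq> leg n" by blast
    then have "imbalance (leg n - {3} \<times> S) = imbalance (leg n) - imbalance ({3} \<times> S)"
      unfolding imbalance_def by (simp add: sum_diff finite_leg)
    also have "imbalance (leg n) = 0" unfolding leg_def by (rule imbalance_rectangle)
    finally have "imbalance (leg n - {3} \<times> S) = - imbalance ({3} \<times> S)" by simp
    moreover have "imbalance ({3} \<times> S) \<noteq> 0"
    proof -
      have "Pow {1, 2, 3} = {{}, {1}, {2}, {3}, {1, 2}, {1, 3}, {2, 3}, {1, 2, 3 :: int}}"
        by (simp add: Pow_insert insert_commute)
      with that consider "S = {1}" | "S = {2}" | "S = {3}" | "S = {1, 3}" | "S = {1, 2, 3}"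
        by (simp only:) blast
      then show ?thesis
        by cases (simp_all add: imbalance_def flip: sum.cartesian_product)
    qed
    ultimately have "num_tilings (leg n - {3} \<times> S) = 0"
      by (intro num_tilings_eq_0_if_unbalanced) (simp_all add: finite_leg)
    then show ?thesis by simp
  qed
  have "L3 (2 * n) (2 * k) = (\<Sum>S\<in>Pow {1, 2, 3}. ?term S)"
    by (rule L3_eq_sum_bridges[OF assms])
  also have "\<dots> = (\<Sum>S\<in>{{}, {1, 2}, {2, 3}}. ?term S)"
    by (rule sum.mono_neutral_right) (use unbalanced in auto)
  also have "\<dots> = ?term {} + ?term {1, 2} + ?term {2, 3}"
  proof -
    have "1 \<in> {1, 2} - {2, 3 :: int}" by simp
    then have "{1, 2} \<noteq> {2, 3 :: int}" by blast
    then show ?thesis by (simp add: add.assoc)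
  qed
  also have "\<dots> = A n * A k + C (n - 1) * B (k - 1) + B (n - 2) * B (k - 1)"
  proof -
    have "n \<ge> 1" using assms(1) by simp
    then show ?thesis
      using assms by (simp only: Sigma_empty2 Diff_empty num_tilings_leg num_tilings_leg_low
          num_tilings_leg_high num_tilings_arm num_tilings_arm_low num_tilings_arm_high)
  qed
  finally show ?thesis .
qed

end
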